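(* Let $\lambda_\alpha>0$ be a nonzero eigenvalue of the combinatorial Laplacian of a fixed connected undirected weighted graph, let $K\ge0$ be locally integrable on $[0,\infty)$, $S(t)=\int_0^tK(u)\,\mathrm du$, and $D>0$. Let $c_\alpha$ be the real-valued process solving $$\mathrm dc_\alpha=-\lambda_\alpha K(t)\,c_\alpha\,\mathrm dt+\sqrt{2D}\,\mathrm dW_{\alpha,t},$$ where $W_{\alpha,t}$ is a standard one-dimensional Brownian motion and $c_\alpha(0)$ is square integrable and independent of $W_\alpha$. Let $m_\alpha(t)=\mathbb E[c_\alpha(t)]$ and $v_\alpha(t)=\operatorname{Var}[c_\alpha(t)]$. Then for all $t\ge0$ $$m_\alpha(t)=m_\alpha(0)\,\mathrm e^{-\lambda_\alpha S(t)},$$ $$v_\alpha(t)=v_\alpha(0)\,\mathrm e^{-2\lambda_\alpha S(t)}+2D\int_0^t\mathrm e^{-2\lambda_\alpha[S(t)-S(u)]}\,\mathrm du.$$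
   Context: The process $c_\alpha$ is the coefficient along the eigenvector with eigenvalue $\lambda_\alpha$ of the graph Laplacian $L=\mathrm{diag}(\text{degrees})-A$ in the linearization of a noisy Kuramoto network near a coherent state. *)

theory Defs
  imports "HOL-Probability.Probability" "Jordan_Normal_Form.Char_Poly"
begin

(* Undirected weighted graph on {0..<n}, given by its weighted adjacency matrix; weight 0 means
   that there is no edge. A loop would cancel in the Laplacian, so the diagonal is left free. *)
definition weighted_adjacency :: "nat \<Rightarrow> real mat \<Rightarrow> bool" where
  "weighted_adjacency n A \<longleftrightarrow>
     A \<in> carrier_mat n n \<and> transpose_mat A = A \<and> (\<forall>i<n. \<forall>j<n. 0 \<le> A $$ (i, j))"

definition weighted_edges :: "nat \<Rightarrow> real mat \<Rightarrow> (nat \<times> nat) set" where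
  "weighted_edges n A = {(i, j). i < n \<and> j < n \<and> 0 < A $$ (i, j)}"

definition weighted_connected :: "nat \<Rightarrow> real mat \<Rightarrow> bool" where
  "weighted_connected n A \<longleftrightarrow> 0 < n \<and> (\<forall>i<n. \<forall>j<n. (i, j) \<in> (weighted_edges n A)\<^sup>*)"

definition weighted_degree :: "nat \<Rightarrow> real mat \<Rightarrow> nat \<Rightarrow> real" where
  "weighted_degree n A i = (\<Sum>j<n. A $$ (i, j))"

definition graph_laplacian :: "nat \<Rightarrow> real mat \<Rightarrow> real mat" where
  "graph_laplacian n A = mat_diag n (weighted_degree n A) - A"

definition locally_integrable_halfline :: "(real \<Rightarrow> real) \<Rightarrow> bool" where
  "locally_integrable_halfline f \<longleftrightarrow> (\<forall>t\<ge>0. set_integrable lebesgue {0..t} f)"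

(* Processes are functions of a real time parameter; only times t >= 0 are constrained. *)
definition (in prob_space) standard_brownian_motion :: "(real \<Rightarrow> 'a \<Rightarrow> real) \<Rightarrow> bool" where
  "standard_brownian_motion W \<longleftrightarrow>
     (\<forall>t\<ge>0. random_variable borel (W t)) \<and>
     (AE \<omega> in M. W 0 \<omega> = 0) \<and>
     (AE \<omega> in M. continuous_on {0..} (\<lambda>t. W t \<omega>)) \<and>
     (\<forall>s t. 0 \<le> s \<and> s < t \<longrightarrow>
        distributed M lborel (\<lambda>\<omega>. W t \<omega> - W s \<omega>) (normal_density 0 (sqrt (t - s)))) \<and>
     (\<forall>(n::nat) \<tau>. 0 \<le> \<tau> 0 \<and> (\<forall>i<n. \<tau> i < \<tau> (Suc i)) \<longrightarrow>
        indep_vars (\<lambda>_. borel) (\<lambda>i \<omega>. W (\<tau> (Suc i)) \<omega> - W (\<tau> i) \<omega>) {..<n})"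

(* Independence of a real random variable from a whole process (W t), t >= 0, that is,
   from the sigma-algebra generated by all of its coordinates. The type of indep_var does not
   allow value spaces of different types, hence the formulation by generated sigma-algebras. *)
definition (in prob_space) indep_of_process :: "('a \<Rightarrow> real) \<Rightarrow> (real \<Rightarrow> 'a \<Rightarrow> real) \<Rightarrow> bool" where
  "indep_of_process X W \<longleftrightarrow>
     indep_set
       (sets (vimage_algebra (space M) X borel))
       (sets (vimage_algebra (space M) (\<lambda>\<omega>. \<lambda>t\<in>{0..}. W t \<omega>) (Pi\<^sub>M {0..} (\<lambda>_. borel))))"

(* X solves dX = b(t, X) dt + s dW on [0, \<infinity>) with a constant noise amplitude s. The
   stochastic integral of a constant is s * (W t - W 0), so the integral form of the equation can
   be written pathwise, with one null set for all times. *)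
definition (in prob_space) solves_additive_noise_sde ::
  "(real \<Rightarrow> real \<Rightarrow> real) \<Rightarrow> real \<Rightarrow> (real \<Rightarrow> 'a \<Rightarrow> real) \<Rightarrow> (real \<Rightarrow> 'a \<Rightarrow> real) \<Rightarrow> bool" where
  "solves_additive_noise_sde b s W X \<longleftrightarrow>
     (\<forall>t\<ge>0. random_variable borel (X t)) \<and>
     (AE \<omega> in M. continuous_on {0..} (\<lambda>t. X t \<omega>) \<and>
        (\<forall>t\<ge>0. set_integrable lebesgue {0..t} (\<lambda>u. b u (X u \<omega>)) \<and>
           X t \<omega> = X 0 \<omega> + (LINT u:{0..t}|lebesgue. b u (X u \<omega>)) + s * (W t \<omega> - W 0 \<omega>)))"

end

theory Submission
  imports Defs
begin

text \<open>
  Write \<open>L = lam * S\<close> and compare the increments of \<open>exp L * c\<close> over the cells of a uniform grid on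
  \<open>[0, T]\<close> with \<open>sqrt (2 * D) * exp (L t\<^sub>i\<^sub>+\<^sub>1) * (W t\<^sub>i\<^sub>+\<^sub>1 - W t\<^sub>i)\<close>. Pathwise, the discrepancy on a cell is
  \<open>o(1)\<close> times the increment of \<open>L\<close>, so it sums to \<open>o(1)\<close>; hence \<open>exp (L T) * c T - c 0\<close> is almost
  surely the limit \<open>Z\<close> of Gaussian sums whose variances are Riemann sums of \<open>2 * D * exp (2 * L)\<close>.
  No Ito calculus and no integration by parts is needed. By Levy's uniqueness theorem \<open>Z\<close> is
  centred Gaussian with the limiting variance, and, being a limit of functions of \<open>W\<close>, it is
  independent of \<open>c 0\<close>. The moments of \<open>c T = exp (- L T) * (c 0 + Z)\<close> follow.
\<close>

section \<open>Uniform grids and the convergence of sums over their cells\<close>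

definition grid :: "real \<Rightarrow> nat \<Rightarrow> nat \<Rightarrow> real" where
  "grid T n i = T * real i / real (Suc n)"

lemma grid_0 [simp]: "grid T n 0 = 0"
  by (simp add: grid_def)

lemma grid_end [simp]: "grid T n (Suc n) = T"
  by (simp add: grid_def del: of_nat_Suc)

lemma grid_diff: "grid T n (Suc i) - grid T n i = T / real (Suc n)"
  unfolding grid_def by (simp add: diff_divide_distrib[symmetric] algebra_simps)

lemma grid_less: "T > 0 \<Longrightarrow> grid T n i < grid T n (Suc i)"
  using grid_diff[of T n i] by (smt (verit) divide_pos_pos of_nat_0_less_iff zero_less_Suc)

lemma grid_nonneg: "T > 0 \<Longrightarrow> 0 \<le> grid T n i"
  by (simp add: grid_def)

lemma grid_le: "T > 0 \<Longrightarrow> i \<le> Suc n \<Longrightarrow> grid T n i \<le> T"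
  by (simp add: grid_def field_simps del: of_nat_Suc)

text \<open>
  Sewing on uniform grids: \<open>G\<close> acts as a control, so that the errors of the local approximations
  \<open>g a b\<close> of the increments of \<open>F\<close> telescope to \<open>e * (G T - G 0)\<close>.
\<close>

lemma sum_grid_tendsto:
  fixes F G :: "real \<Rightarrow> real" and g :: "real \<Rightarrow> real \<Rightarrow> real"
  assumes T: "T > 0"
    and approx: "\<And>e. e > 0 \<Longrightarrow> \<exists>d>0. \<forall>a b. 0 \<le> a \<and> a \<le> b \<and> b \<le> T \<and> b - a < d \<longrightarrow>
            \<bar>F b - F a - g a b\<bar> \<le> e * (G b - G a)"
  shows "(\<lambda>n. \<Sum>i<Suc n. g (grid T n i) (grid T n (Suc i))) \<longlonglongrightarrow> F T - F 0"
proof (rule LIMSEQ_I)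
  fix r :: real assume r: "r > 0"
  \<comment> \<open>\<open>G\<close> need not be monotone here, hence the absolute value. The added
    1 makes \<open>C\<close> positive and the final bound by \<open>r\<close> strict.\<close>
  define C where "C = \<bar>G T - G 0\<bar> + 1"
  have C: "C > 0" by (simp add: C_def)
  from approx[of "r / C"] r C obtain d where d: "d > 0"
    and dd: "\<And>a b. 0 \<le> a \<Longrightarrow> a \<le> b \<Longrightarrow> b \<le> T \<Longrightarrow> b - a < d \<Longrightarrow>
            \<bar>F b - F a - g a b\<bar> \<le> r / C * (G b - G a)"
    by (auto simp del: times_divide_eq_left)
  have "(\<lambda>n. T / real (Suc n)) \<longlonglongrightarrow> 0"
    by (rule LIMSEQ_Suc) (rule lim_const_over_n)
  then obtain N where N: "\<And>n. n \<ge> N \<Longrightarrow> T / real (Suc n) < d"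
    using d unfolding LIMSEQ_iff by (metis abs_less_iff diff_zero real_norm_def)
  have "norm ((\<Sum>i<Suc n. g (grid T n i) (grid T n (Suc i))) - (F T - F 0)) < r" if n: "n \<ge> N" for n
  proof -
    have FT: "(\<Sum>i<Suc n. F (grid T n (Suc i)) - F (grid T n i)) = F T - F 0"
      using sum_lessThan_telescope[of "\<lambda>i. F (grid T n i)" "Suc n"] by (simp only: grid_0 grid_end)
    have GT: "(\<Sum>i<Suc n. G (grid T n (Suc i)) - G (grid T n i)) = G T - G 0"
      using sum_lessThan_telescope[of "\<lambda>i. G (grid T n i)" "Suc n"] by (simp only: grid_0 grid_end)
    have "\<bar>(F T - F 0) - (\<Sum>i<Suc n. g (grid T n i) (grid T n (Suc i)))\<bar>
        = \<bar>\<Sum>i<Suc n. F (grid T n (Suc i)) - F (grid T n i) - g (grid T n i) (grid T n (Suc i))\<bar>"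
      unfolding FT[symmetric] by (simp only: sum_subtractf)
    also have "\<dots> \<le> (\<Sum>i<Suc n. \<bar>F (grid T n (Suc i)) - F (grid T n i) - g (grid T n i) (grid T n (Suc i))\<bar>)"
      by (rule sum_abs)
    also have "\<dots> \<le> (\<Sum>i<Suc n. r / C * (G (grid T n (Suc i)) - G (grid T n i)))"
    proof (rule sum_mono)
      fix i assume "i \<in> {..<Suc n}"
      then have "Suc i \<le> Suc n" by simp
      then show "\<bar>F (grid T n (Suc i)) - F (grid T n i) - g (grid T n i) (grid T n (Suc i))\<bar>
          \<le> r / C * (G (grid T n (Suc i)) - G (grid T n i))"
        using N[OF n] by (intro dd grid_nonneg grid_le T less_imp_le[OF grid_less]) (simp_all only: grid_diff)
    qed
    also have "\<dots> = r / C * (G T - G 0)"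
      by (simp only: sum_distrib_left[symmetric] GT)
    also have "\<dots> < r / C * C"
      using r C by (intro mult_strict_left_mono) (auto simp: C_def)
    also have "\<dots> = r" using C by simp
    finally show ?thesis by (simp only: real_norm_def abs_minus_commute)
  qed
  then show "\<exists>no. \<forall>n\<ge>no. norm ((\<Sum>i<Suc n. g (grid T n i) (grid T n (Suc i))) - (F T - F 0)) < r"
    by blast
qed

lemma integral_diff_initial:
  fixes f :: "real \<Rightarrow> real"
  assumes "f integrable_on {0..T}" "0 \<le> a" "a \<le> b" "b \<le> T"
  shows "integral {0..b} f - integral {0..a} f = integral {a..b} f"
proof -
  have "f integrable_on {0..b}"
    by (rule integrable_subinterval_real[OF assms(1)]) (use assms in auto)
  from Henstock_Kurzweil_Integration.integral_combine[OF assms(2,3) this] show ?thesis by simp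
qed

lemma uniformly_continuous_dist:
  fixes f :: "real \<Rightarrow> real"
  assumes "continuous_on {0..T} f" "e > 0"
  obtains d where "d > 0" "\<And>u v. u \<in> {0..T} \<Longrightarrow> v \<in> {0..T} \<Longrightarrow> \<bar>u - v\<bar> < d \<Longrightarrow> \<bar>f u - f v\<bar> < e"
  using compact_uniformly_continuous[OF assms(1) compact_Icc] assms(2)
  unfolding uniformly_continuous_on_def dist_real_def by metis

text \<open>Sewing with the control \<open>G u = u\<close>: on a cell shorter than the modulus of
  uniform continuity, \<open>f\<close> stays within \<open>e\<close> of its value at the right
  endpoint. Right endpoints are chosen because the Gaussian sums carry their weights there.\<close>

lemma riemann_sum_tendsto:
  fixes f :: "real \<Rightarrow> real"
  assumes T: "T > 0" and f: "continuous_on {0..T} f"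
  shows "(\<lambda>n. \<Sum>i<Suc n. f (grid T n (Suc i)) * (grid T n (Suc i) - grid T n i)) \<longlonglongrightarrow> integral {0..T} f"
proof -
  have "(\<lambda>n. \<Sum>i<Suc n. f (grid T n (Suc i)) * (grid T n (Suc i) - grid T n i))
      \<longlonglongrightarrow> integral {0..T} f - integral {0..0} f"
  proof (rule sum_grid_tendsto[where G = "\<lambda>u. u" and g = "\<lambda>a b. f b * (b - a)", OF T])
    fix e :: real assume "e > 0"
    then obtain d where d: "d > 0"
      and dd: "\<And>u v. u \<in> {0..T} \<Longrightarrow> v \<in> {0..T} \<Longrightarrow> \<bar>u - v\<bar> < d \<Longrightarrow> \<bar>f u - f v\<bar> < e"
      using uniformly_continuous_dist[OF f] by blast
    have fi: "f integrable_on {0..T}" by (rule integrable_continuous_real[OF f])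
    have "\<bar>integral {0..b} f - integral {0..a} f - f b * (b - a)\<bar> \<le> e * (b - a)"
      if ab: "0 \<le> a" "a \<le> b" "b \<le> T" "b - a < d" for a b
    proof -
      have fab: "f integrable_on {a..b}"
        by (rule integrable_subinterval_real[OF fi]) (use ab in auto)
      have "integral {a..b} f - f b * (b - a) = integral {a..b} (\<lambda>u. f u - f b)"
        using fab ab by (subst Henstock_Kurzweil_Integration.integral_diff) auto
      also have "\<bar>\<dots>\<bar> \<le> integral {a..b} (\<lambda>u. e)"
      proof (rule integral_norm_bound_integral[where 'a=real, unfolded real_norm_def])
        show "(\<lambda>u. f u - f b) integrable_on {a..b}" using fab by (intro integrable_diff) auto
        show "\<bar>f u - f b\<bar> \<le> e" if "u \<in> {a..b}" for u
          using dd[of u b] that ab by auto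
      qed auto
      also have "\<dots> = e * (b - a)" using ab by simp
      finally show ?thesis using integral_diff_initial[OF fi ab(1-3)] by simp
    qed
    then show "\<exists>d>0. \<forall>a b. 0 \<le> a \<and> a \<le> b \<and> b \<le> T \<and> b - a < d \<longrightarrow>
        \<bar>integral {0..b} f - integral {0..a} f - f b * (b - a)\<bar> \<le> e * (b - a)"
      using d by blast
  qed
  then show ?thesis by simp
qed

section \<open>The pathwise integrating factor\<close>

lemma exp_neg_second_order:
  fixes d :: real
  assumes "d \<ge> 0"
  shows "\<bar>1 - exp (- d) - d\<bar> \<le> d\<^sup>2"
proof -
  have "1 + d \<le> exp d" by (rule exp_ge_add_one_self)
  then have "exp (- d) \<le> 1 / (1 + d)"
    using assms by (simp add: exp_minus field_simps)
  \<comment> \<open>Multiplying out, (1 + d) * (1 - d + d^2) = 1 + d^3, which is at least 1.\<close>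
  also have "\<dots> \<le> 1 - d + d\<^sup>2"
    using assms by (simp add: field_simps power2_eq_square)
  finally show ?thesis
    using exp_ge_add_one_self[of "- d"] by auto
qed

text \<open>On a cell from \<open>u\<close> to \<open>v\<close> two errors arise: \<open>x\<close>
  is frozen at \<open>u\<close> in the drift integral, and 1 - exp (- l) is replaced by l, the
  increment of \<open>L\<close>. Uniform continuity of \<open>x\<close> and \<open>L\<close> makes
  both o(1) * l. Since \<open>k\<close> may be unbounded, errors are measured by increments of
  \<open>L\<close> and not by cell lengths, so \<open>L\<close> is the control for sewing.\<close>

lemma integrating_factor_sums:
  fixes k x b L :: "real \<Rightarrow> real"
  assumes T: "T > 0"
    and k: "k integrable_on {0..T}" "\<And>u. u \<in> {0..T} \<Longrightarrow> 0 \<le> k u"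
    and x: "continuous_on {0..T} x"
    and kx: "(\<lambda>u. k u * x u) integrable_on {0..T}"
    and eq: "\<And>t. t \<in> {0..T} \<Longrightarrow> x t = x 0 - integral {0..t} (\<lambda>u. k u * x u) + b t"
    and L: "\<And>t. t \<in> {0..T} \<Longrightarrow> L t = integral {0..t} k"
  shows "(\<lambda>n. \<Sum>i<Suc n. exp (L (grid T n (Suc i))) * (b (grid T n (Suc i)) - b (grid T n i)))
     \<longlonglongrightarrow> exp (L T) * x T - x 0"
proof -
  have L0: "L 0 = 0" using L[of 0] T by simp
  have Ldiff: "L v - L u = integral {u..v} k" if "0 \<le> u" "u \<le> v" "v \<le> T" for u v
    using integral_diff_initial[OF k(1) that] L[of u] L[of v] that by simp
  have kuv: "k integrable_on {u..v}" "(\<lambda>r. k r * x r) integrable_on {u..v}"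
    if "0 \<le> u" "v \<le> T" for u v
    by (rule integrable_subinterval_real[OF k(1)] integrable_subinterval_real[OF kx], use that in auto)+
  have Lmono: "L u \<le> L v" if "0 \<le> u" "u \<le> v" "v \<le> T" for u v
    using Ldiff[OF that] integral_nonneg[OF kuv(1)[of u v]] k(2) that by force
  have Lcont: "continuous_on {0..T} L"
    using indefinite_integral_continuous_1[OF k(1)] by (rule continuous_on_eq) (simp add: L)
  have "bounded (x ` {0..T})"
    by (intro compact_imp_bounded compact_continuous_image x compact_Icc)
  then obtain B where B: "\<And>u. u \<in> {0..T} \<Longrightarrow> \<bar>x u\<bar> \<le> B"
    unfolding bounded_iff real_norm_def by blast
  have B0: "B \<ge> 0" using B[of 0] T by auto
  define C where "C = exp (L T) * (B + 1)"
  have C: "C > 0" unfolding C_def using B0 by simp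
  have "(\<lambda>n. \<Sum>i<Suc n. exp (L (grid T n (Suc i))) * (b (grid T n (Suc i)) - b (grid T n i)))
     \<longlonglongrightarrow> exp (L T) * x T - exp (L 0) * x 0"
  proof (rule sum_grid_tendsto[where G = L and F = "\<lambda>t. exp (L t) * x t"
        and g = "\<lambda>u v. exp (L v) * (b v - b u)", OF T])
    fix e :: real assume "e > 0"
    then have e: "e / C > 0" using C by simp
    obtain d1 where d1: "d1 > 0"
      and dd1: "\<And>u v. u \<in> {0..T} \<Longrightarrow> v \<in> {0..T} \<Longrightarrow> \<bar>u - v\<bar> < d1 \<Longrightarrow> \<bar>L u - L v\<bar> < e / C"
      using uniformly_continuous_dist[OF Lcont e] by blast
    obtain d2 where d2: "d2 > 0"
      and dd2: "\<And>u v. u \<in> {0..T} \<Longrightarrow> v \<in> {0..T} \<Longrightarrow> \<bar>u - v\<bar> < d2 \<Longrightarrow> \<bar>x u - x v\<bar> < e / C"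
      using uniformly_continuous_dist[OF x e] by blast
    have "\<bar>exp (L v) * x v - exp (L u) * x u - exp (L v) * (b v - b u)\<bar> \<le> e * (L v - L u)"
      if uv: "0 \<le> u" "u \<le> v" "v \<le> T" "v - u < min d1 d2" for u v
    proof -
      define l where "l = L v - L u"
      have l: "l \<ge> 0" using Lmono[OF uv(1-3)] by (simp add: l_def)
      have le: "l \<le> e / C" using dd1[of v u] uv by (auto simp: l_def)
      have lint: "l = integral {u..v} k" using Ldiff[OF uv(1-3)] by (simp add: l_def)
      \<comment> \<open>\<open>J\<close> is the error made by freezing \<open>x\<close> at the left
        endpoint, so that the drift over the cell is \<open>J + x u * l\<close> up to sign.\<close>
      define J where "J = integral {u..v} (\<lambda>r. k r * (x r - x u))"
      have Jeq: "integral {u..v} (\<lambda>r. k r * x r) = J + x u * l"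
      proof -
        have "J = integral {u..v} (\<lambda>r. k r * x r - k r * x u)"
          unfolding J_def by (simp add: algebra_simps)
        also have "\<dots> = integral {u..v} (\<lambda>r. k r * x r) - integral {u..v} (\<lambda>r. k r * x u)"
          using kuv[OF uv(1,3)] by (intro Henstock_Kurzweil_Integration.integral_diff integrable_on_mult_left) auto
        finally show ?thesis by (simp add: lint)
      qed
      have J: "\<bar>J\<bar> \<le> e / C * l"
      proof -
        have "\<bar>J\<bar> \<le> integral {u..v} (\<lambda>r. e / C * k r)"
          unfolding J_def
        proof (rule integral_norm_bound_integral[where 'a=real, unfolded real_norm_def])
          show "(\<lambda>r. k r * (x r - x u)) integrable_on {u..v}"
            using integrable_diff[OF kuv(2)[OF uv(1,3)] integrable_on_mult_left[OF kuv(1)[OF uv(1,3)], of "x u"]]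
            by (simp add: algebra_simps)
          show "(\<lambda>r. e / C * k r) integrable_on {u..v}"
            by (intro integrable_on_mult_right kuv uv)
          show "\<bar>k r * (x r - x u)\<bar> \<le> e / C * k r" if "r \<in> {u..v}" for r
          proof -
            have "\<bar>x r - x u\<bar> \<le> e / C" using dd2[of r u] that uv by auto
            moreover have "k r \<ge> 0" using k(2)[of r] that uv by auto
            ultimately show ?thesis
              unfolding abs_mult using mult_right_mono[of "\<bar>x r - x u\<bar>" "e / C" "k r"]
              by (simp add: mult.commute)
          qed
        qed
        then show ?thesis by (simp add: lint)
      qed
      have inc: "x v - x u - (b v - b u) = - (J + x u * l)"
        using eq[of u] eq[of v] integral_diff_initial[OF kx uv(1-3)] Jeq uv by auto
      have "exp (L u) = exp (L v) * exp (- l)"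
        by (simp add: l_def exp_add[symmetric])
      then have "exp (L v) * x v - exp (L u) * x u - exp (L v) * (b v - b u)
         = exp (L v) * ((x v - x u - (b v - b u)) + x u * (1 - exp (- l)))"
        by (simp add: algebra_simps)
      \<comment> \<open>The drift term \<open>- x u * l\<close> cancels the first-order part of
        \<open>x u * (1 - exp (- l))\<close>, so only a second-order term and \<open>J\<close>
        remain.\<close>
      also have "\<dots> = exp (L v) * (x u * (1 - exp (- l) - l) - J)"
        unfolding inc by (simp add: algebra_simps)
      also have "\<bar>\<dots>\<bar> \<le> exp (L T) * (B * (e / C * l) + e / C * l)"
      proof -
        have "\<bar>x u * (1 - exp (- l) - l)\<bar> \<le> B * l\<^sup>2"
          unfolding abs_mult using exp_neg_second_order[OF l] B[of u] uv B0
          by (intro mult_mono) auto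
        \<comment> \<open>One factor of the square is made small by \<open>l \<le> e / C\<close>;
          the other is kept, to be summed over the cells by telescoping.\<close>
        also have "\<dots> \<le> B * (e / C * l)"
          using mult_right_mono[OF le l] B0 by (intro mult_left_mono) (auto simp: power2_eq_square)
        finally have "\<bar>x u * (1 - exp (- l) - l) - J\<bar> \<le> B * (e / C * l) + e / C * l"
          using J by linarith
        then show ?thesis
          unfolding abs_mult using Lmono[of v T] uv by (intro mult_mono) auto
      qed
      also have "\<dots> = C * (e / C * l)"
        unfolding C_def by (simp only: distrib_right distrib_left mult.assoc mult_1_left)
      also have "\<dots> = e * l" using C by simp
      finally show ?thesis by (simp add: l_def)
    qed
    then show "\<exists>d>0. \<forall>u v. 0 \<le> u \<and> u \<le> v \<and> v \<le> T \<and> v - u < d \<longrightarrow>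
        \<bar>exp (L v) * x v - exp (L u) * x u - exp (L v) * (b v - b u)\<bar> \<le> e * (L v - L u)"
      using d1 d2 by (intro exI[of _ "min d1 d2"]) auto
  qed
  then show ?thesis by (simp add: L0)
qed

section \<open>Gaussian limits of weighted Brownian increments\<close>

lemma (in prob_space) normal_AE_limit:
  fixes X :: "nat \<Rightarrow> 'a \<Rightarrow> real"
  assumes X: "\<And>n. distributed M lborel (X n) (normal_density 0 (\<sigma> n))"
    and \<sigma>: "\<And>n. \<sigma> n > 0" "\<sigma> \<longlonglongrightarrow> s" and s: "s > 0"
    and Z[measurable]: "Z \<in> borel_measurable M"
    and lim: "AE \<omega> in M. (\<lambda>n. X n \<omega>) \<longlonglongrightarrow> Z \<omega>"
  shows "distributed M lborel Z (normal_density 0 s)"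
proof -
  have X_meas[measurable]: "X n \<in> borel_measurable M" for n
    using distributed_measurable[OF X[of n]] by simp
  \<comment> \<open>After normalisation all terms have the same law, so their characteristic
    functions do not depend on \<open>n\<close>. Dominated convergence hands this common function on
    to \<open>Z / s\<close>, and Levy's uniqueness theorem identifies its law. The passages between
    \<open>lborel\<close> and \<open>borel\<close> are harmless, as both have the same sets.\<close>
  have Y: "distributed M lborel (\<lambda>\<omega>. X n \<omega> / \<sigma> n) std_normal_density" for n
    using X[of n] normal_standard_normal_convert[OF \<sigma>(1)[of n], of "X n" 0] by simp
  have distrY: "distr M borel (\<lambda>\<omega>. X n \<omega> / \<sigma> n) = std_normal_distribution" for n
    using distributed_distr_eq_density[OF Y[of n]]
    by (subst distr_cong[where K = M and N = borel and L = lborel]) auto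
  let ?V = "\<lambda>\<omega>. Z \<omega> / s"
  have "char (distr M borel ?V) t = char std_normal_distribution t" for t
  proof -
    have "(\<lambda>n. CLINT \<omega>|M. iexp (t * (X n \<omega> / \<sigma> n))) \<longlonglongrightarrow> (CLINT \<omega>|M. iexp (t * ?V \<omega>))"
    proof (rule integral_dominated_convergence[where w = "\<lambda>_. 1"])
      show "AE \<omega> in M. (\<lambda>n. iexp (t * (X n \<omega> / \<sigma> n))) \<longlonglongrightarrow> iexp (t * ?V \<omega>)"
        using lim
      proof eventually_elim
        case (elim \<omega>)
        have "(\<lambda>n. t * (X n \<omega> / \<sigma> n)) \<longlonglongrightarrow> t * ?V \<omega>"
          using s by (intro tendsto_intros elim \<sigma>(2)) auto
        then show ?case
          by (rule isCont_tendsto_compose[OF isCont_iexp])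
      qed
    qed auto
    moreover have "(CLINT \<omega>|M. iexp (t * (X n \<omega> / \<sigma> n))) = char std_normal_distribution t" for n
    proof -
      have "char (distr M borel (\<lambda>\<omega>. X n \<omega> / \<sigma> n)) t = (CLINT \<omega>|M. iexp (t * (X n \<omega> / \<sigma> n)))"
        unfolding char_def by (rule integral_distr) measurable
      then show ?thesis by (simp only: distrY)
    qed
    moreover have "char (distr M borel ?V) t = (CLINT \<omega>|M. iexp (t * ?V \<omega>))"
      unfolding char_def by (rule integral_distr) measurable
    ultimately show ?thesis
      by (simp only: LIMSEQ_const_iff)
  qed
  then have "distr M borel ?V = std_normal_distribution"
    by (intro Levy_uniqueness real_distribution_distr real_dist_normal_dist) auto
  then have "distributed M lborel ?V std_normal_density"
    unfolding distributed_def
    by (subst distr_cong[where K = M and N = lborel and L = borel]) auto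
  then show ?thesis
    using normal_standard_normal_convert[OF s, of Z 0] by simp
qed

text \<open>An approximating sum for the Wiener integral of a deterministic \<open>g\<close> over
  [0, T]. The evaluation at right endpoints is the one that \<open>integrating_factor_sums\<close>
  produces.\<close>

definition wiener_sum :: "(real \<Rightarrow> 'a \<Rightarrow> real) \<Rightarrow> (real \<Rightarrow> real) \<Rightarrow> real \<Rightarrow> nat \<Rightarrow> 'a \<Rightarrow> real" where
  "wiener_sum W g T n \<omega> =
     (\<Sum>i<Suc n. g (grid T n (Suc i)) * (W (grid T n (Suc i)) \<omega> - W (grid T n i) \<omega>))"

text \<open>The summands are independent centred normals, so each sum is normal and its variance is
  a Riemann sum of the square of \<open>g\<close>. Positivity of \<open>g\<close> keeps all standard
  deviations positive, including the limiting one, as \<open>sum_indep_normal\<close> and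
  \<open>normal_AE_limit\<close> demand.\<close>

lemma (in prob_space) wiener_sum_limit_normal:
  assumes W: "standard_brownian_motion W" and T: "T > 0"
    and g: "continuous_on {0..T} g" "\<And>u. u \<in> {0..T} \<Longrightarrow> 0 < g u"
    and Z: "Z \<in> borel_measurable M"
    and lim: "AE \<omega> in M. (\<lambda>n. wiener_sum W g T n \<omega>) \<longlonglongrightarrow> Z \<omega>"
  shows "distributed M lborel Z (normal_density 0 (sqrt (integral {0..T} (\<lambda>u. (g u)\<^sup>2))))"
proof (rule normal_AE_limit[OF _ _ _ _ Z lim])
  let ?v = "\<lambda>n i. g (grid T n (Suc i)) * sqrt (grid T n (Suc i) - grid T n i)"
  have pos: "?v n i > 0" if "i \<in> {..<Suc n}" for n i
  proof -
    have "grid T n (Suc i) \<in> {0..T}"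
      using that by (auto intro: grid_nonneg grid_le T)
    then show ?thesis using g(2) grid_less[OF T, of n i] by simp
  qed
  have sq: "(\<Sum>i<Suc n. (?v n i)\<^sup>2)
      = (\<Sum>i<Suc n. (g (grid T n (Suc i)))\<^sup>2 * (grid T n (Suc i) - grid T n i))" for n
    using grid_less[OF T, of n] by (intro sum.cong refl) (simp add: power_mult_distrib less_imp_le)
  show "distributed M lborel (wiener_sum W g T n) (normal_density 0 (sqrt (\<Sum>i<Suc n. (?v n i)\<^sup>2)))" for n
  proof -
    let ?I = "\<lambda>i \<omega>. W (grid T n (Suc i)) \<omega> - W (grid T n i) \<omega>"
    have ind: "indep_vars (\<lambda>_. borel) ?I {..<Suc n}"
    proof -
      have "0 \<le> grid T n 0 \<and> (\<forall>i<Suc n. grid T n i < grid T n (Suc i))"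
        using grid_less[OF T] by simp
      then show ?thesis
        using W unfolding standard_brownian_motion_def by blast
    qed
    have ind': "indep_vars (\<lambda>_. borel) (\<lambda>i \<omega>. g (grid T n (Suc i)) * ?I i \<omega>) {..<Suc n}"
      by (rule indep_vars_compose2[OF ind]) auto
    have normal: "distributed M lborel (\<lambda>\<omega>. g (grid T n (Suc i)) * ?I i \<omega>) (normal_density 0 (?v n i))"
      if i: "i \<in> {..<Suc n}" for i
    proof -
      have D: "distributed M lborel (?I i) (normal_density 0 (sqrt (grid T n (Suc i) - grid T n i)))"
        using W grid_less[OF T, of n i] grid_nonneg[OF T, of n i]
        unfolding standard_brownian_motion_def by blast
      have gp: "g (grid T n (Suc i)) > 0"
        using i by (intro g(2)) (auto intro: grid_nonneg grid_le T)
      show ?thesis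
        using normal_density_affine[OF D, of "g (grid T n (Suc i))" 0] gp grid_less[OF T, of n i]
        by simp
    qed
    have "distributed M lborel (\<lambda>\<omega>. \<Sum>i\<in>{..<Suc n}. g (grid T n (Suc i)) * ?I i \<omega>)
        (normal_density (\<Sum>i\<in>{..<Suc n}. 0) (sqrt (\<Sum>i\<in>{..<Suc n}. (?v n i)\<^sup>2)))"
      by (rule sum_indep_normal[OF _ _ ind' pos normal]) auto
    then show ?thesis
      by (simp only: wiener_sum_def[abs_def] sum.neutral_const)
  qed
  show "0 < sqrt (\<Sum>i<Suc n. (?v n i)\<^sup>2)" for n
    using pos by (intro real_sqrt_gt_zero sum_pos zero_less_power) auto
  have g2: "continuous_on {0..T} (\<lambda>u. (g u)\<^sup>2)" by (intro continuous_intros g)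
  show "(\<lambda>n. sqrt (\<Sum>i<Suc n. (?v n i)\<^sup>2)) \<longlonglongrightarrow> sqrt (integral {0..T} (\<lambda>u. (g u)\<^sup>2))"
    unfolding sq by (intro tendsto_real_sqrt riemann_sum_tendsto T g2)
  have "integral {0..T} (\<lambda>u. (g u)\<^sup>2) \<noteq> 0"
    using integral_eq_0_iff[OF g2 T] g(2)[of 0] T by fastforce
  moreover have "integral {0..T} (\<lambda>u. (g u)\<^sup>2) \<ge> 0"
    by (intro integral_nonneg integrable_continuous_real g2) auto
  ultimately show "0 < sqrt (integral {0..T} (\<lambda>u. (g u)\<^sup>2))" by simp
qed

section \<open>Independence, measurability and moments\<close>

lemma (in prob_space) indep_of_process_imp_indep_var:
  assumes ind: "indep_of_process X W" and X: "random_variable borel X"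
    and Z: "Z \<in> borel_measurable (vimage_algebra (space M) (\<lambda>\<omega>. \<lambda>t\<in>{0..}. W t \<omega>) (Pi\<^sub>M {0..} (\<lambda>_. borel)))"
  shows "indep_var borel X borel Z"
proof -
  let ?V = "vimage_algebra (space M) (\<lambda>\<omega>. \<lambda>t\<in>{0..}. W t \<omega>) (Pi\<^sub>M {0..} (\<lambda>_. borel))"
  have sub: "sigma_sets (space M) {Z -` A \<inter> space M |A. A \<in> sets borel} \<subseteq> sets ?V"
  proof -
    have "{Z -` A \<inter> space M |A. A \<in> sets borel} \<subseteq> sets ?V"
      using measurable_sets[OF Z] by auto
    then show ?thesis
      using sets.sigma_sets_subset[of _ ?V] by simp
  qed
  \<comment> \<open>\<open>indep_set\<close> includes that both families consist of events; this is
    what makes \<open>Z\<close> a random variable on \<open>M\<close>.\<close>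
  have "sets ?V \<subseteq> events"
    using ind unfolding indep_of_process_def by (rule indep_setD_ev2)
  then have Zm: "random_variable borel Z"
    by (intro measurable_mono[THEN subsetD, OF _ _ _ _ Z]) auto
  have "indep_set (sigma_sets (space M) {X -` A \<inter> space M |A. A \<in> sets borel})
      (sigma_sets (space M) {Z -` A \<inter> space M |A. A \<in> sets borel})"
    using ind sub unfolding indep_of_process_def indep_sets2_eq sets_vimage_algebra by blast
  with X Zm show ?thesis
    unfolding indep_var_eq by simp
qed

text \<open>The measure \<open>N\<close> is arbitrary because two instances are needed: the
  sigma-algebra generated by the process, for independence from the initial value, and
  \<open>M\<close> itself, for the law of the limit.\<close>

lemma wiener_sum_measurable:
  assumes T: "T > 0" and W: "\<And>t. t \<ge> 0 \<Longrightarrow> W t \<in> borel_measurable N"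
  shows "wiener_sum W g T n \<in> borel_measurable N"
  unfolding wiener_sum_def[abs_def]
  by (intro borel_measurable_sum borel_measurable_times borel_measurable_diff borel_measurable_const
      W grid_nonneg T)

lemma process_measurable_vimage_algebra:
  assumes "t \<in> I"
  shows "W t \<in> vimage_algebra X (\<lambda>\<omega>. \<lambda>t\<in>I. W t \<omega>) (Pi\<^sub>M I (\<lambda>_. borel)) \<rightarrow>\<^sub>M borel"
proof -
  have "(\<lambda>\<omega>. \<lambda>t\<in>I. W t \<omega>)
      \<in> vimage_algebra X (\<lambda>\<omega>. \<lambda>t\<in>I. W t \<omega>) (Pi\<^sub>M I (\<lambda>_. borel)) \<rightarrow>\<^sub>M Pi\<^sub>M I (\<lambda>_. borel)"
    by (rule measurable_vimage_algebra1) (auto simp: space_PiM)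
  from measurable_compose[OF this measurable_component_singleton[of t]] assms
  show ?thesis by simp
qed

text \<open>Independence and the zero mean of \<open>Z\<close> remove the cross term, so the
  variances add. \<open>Y\<close> is tied to \<open>X + Z\<close> only almost everywhere, because
  the equation is solved off a null set; its measurability is therefore a separate
  hypothesis.\<close>

lemma (in prob_space) moments_add_indep_normal:
  assumes X: "random_variable borel X" and X2: "integrable M (\<lambda>\<omega>. (X \<omega>)\<^sup>2)"
    and \<sigma>: "\<sigma> > 0" and Z: "distributed M lborel Z (normal_density 0 \<sigma>)"
    and ind: "indep_var borel X borel Z"
    and Y: "random_variable borel Y" "AE \<omega> in M. Y \<omega> = a * (X \<omega> + Z \<omega>)"
  shows "integrable M (\<lambda>\<omega>. (Y \<omega>)\<^sup>2)"
    and "expectation Y = a * expectation X"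
    and "variance Y = a\<^sup>2 * (variance X + \<sigma>\<^sup>2)"
proof -
  note [measurable] = X Y(1)
  have Zm[measurable]: "random_variable borel Z"
    using distributed_measurable[OF Z] by simp
  have Z2: "integrable M (\<lambda>\<omega>. (Z \<omega>)\<^sup>2)"
    using integrable_normal_moment[OF \<sigma>, of 0 2]
      distributed_integrable[OF Z, of "\<lambda>x. x\<^sup>2"] by simp
  have Xi: "integrable M X" and Zi: "integrable M Z"
    by (rule square_integrable_imp_integrable[OF X X2], rule square_integrable_imp_integrable[OF Zm Z2])
  have XZ: "integrable M (\<lambda>\<omega>. X \<omega> * Z \<omega>)"
    by (rule indep_var_integrable[OF ind Xi Zi])
  have EZ: "expectation Z = 0"
    by (rule normal_distributed_expectation[OF \<sigma> Z])
  have EZ2: "expectation (\<lambda>\<omega>. (Z \<omega>)\<^sup>2) = \<sigma>\<^sup>2"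
    using normal_distributed_variance[OF \<sigma> Z] by (simp add: EZ)
  have EXZ: "expectation (\<lambda>\<omega>. X \<omega> * Z \<omega>) = 0"
    using indep_var_lebesgue_integral[OF ind Xi Zi] EZ by simp
  \<comment> \<open>The expanded square: its three terms are integrable one by one, and
    \<open>Y\<close> inherits square integrability from it.\<close>
  define Q where "Q \<omega> = a\<^sup>2 * (X \<omega>)\<^sup>2 + 2 * a\<^sup>2 * (X \<omega> * Z \<omega>) + a\<^sup>2 * (Z \<omega>)\<^sup>2" for \<omega>
  have Qm[measurable]: "random_variable borel Q" unfolding Q_def by measurable
  have Qi: "integrable M Q" unfolding Q_def using X2 XZ Z2 by auto
  have YQ: "AE \<omega> in M. (Y \<omega>)\<^sup>2 = Q \<omega>"
    using Y(2) by eventually_elim (simp add: Q_def power2_eq_square algebra_simps)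
  show Y2: "integrable M (\<lambda>\<omega>. (Y \<omega>)\<^sup>2)"
    by (rule iffD2[OF integrable_cong_AE Qi]) (use YQ in auto)
  have "expectation Y = expectation (\<lambda>\<omega>. a * (X \<omega> + Z \<omega>))"
    by (rule integral_cong_AE) (use Y in auto)
  then show EY: "expectation Y = a * expectation X"
    using Xi Zi EZ by simp
  have Yi: "integrable M Y"
    using square_integrable_imp_integrable[OF Y(1) Y2] .
  have "expectation (\<lambda>\<omega>. (Y \<omega>)\<^sup>2) = expectation Q"
    by (rule integral_cong_AE) (use YQ in auto)
  also have "\<dots> = a\<^sup>2 * expectation (\<lambda>\<omega>. (X \<omega>)\<^sup>2) + a\<^sup>2 * \<sigma>\<^sup>2"
    unfolding Q_def using X2 XZ Z2 by (simp add: EXZ EZ2)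
  finally show "variance Y = a\<^sup>2 * (variance X + \<sigma>\<^sup>2)"
    using variance_eq[OF Yi Y2] variance_eq[OF Xi X2] unfolding EY
    by (simp add: power_mult_distrib right_diff_distrib distrib_left)
qed

section \<open>The explicit solution and its mean and variance\<close>

lemma locally_integrable_halfline_integral:
  assumes "locally_integrable_halfline f" "t \<ge> 0"
  shows "f integrable_on {0..t}" and "(LINT u:{0..t}|lebesgue. f u) = integral {0..t} f"
  using assms set_lebesgue_integral_eq_integral[of "{0..t}" f]
  unfolding locally_integrable_halfline_def by auto

lemma continuous_on_indefinite_LINT:
  assumes f: "locally_integrable_halfline f"
    and F: "\<And>t. t \<ge> 0 \<Longrightarrow> F t = (LINT u:{0..t}|lebesgue. f u)" and T: "T \<ge> 0"
  shows "continuous_on {0..T} F"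
  using indefinite_integral_continuous_1[OF locally_integrable_halfline_integral(1)[OF f T]]
  by (rule continuous_on_eq) (simp add: F locally_integrable_halfline_integral(2)[OF f])

text \<open>\<open>Z\<close> plays the role of the Wiener integral of
  \<open>s * exp (lam * S u)\<close> over [0, T]. Its measurability with respect to the
  sigma-algebra of \<open>W\<close> is what later yields independence from
  \<open>c 0\<close>.\<close>

lemma (in prob_space) linear_sde_solution:
  fixes W c :: "real \<Rightarrow> 'a \<Rightarrow> real"
  assumes K_nonneg: "\<And>t. t \<ge> 0 \<Longrightarrow> K t \<ge> 0"
    and K_int: "locally_integrable_halfline K"
    and S_eq: "\<And>t. t \<ge> 0 \<Longrightarrow> S t = (LINT u:{0..t}|lebesgue. K u)"
    and lam: "lam \<ge> 0" and s: "s > 0" and T: "T > 0"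
    and W: "standard_brownian_motion W"
    and c: "solves_additive_noise_sde (\<lambda>t x. - lam * K t * x) s W c"
  obtains Z where "Z \<in> borel_measurable
        (vimage_algebra (space M) (\<lambda>\<omega>. \<lambda>t\<in>{0..}. W t \<omega>) (Pi\<^sub>M {0..} (\<lambda>_. borel)))"
    and "AE \<omega> in M. c T \<omega> = exp (- lam * S T) * (c 0 \<omega> + Z \<omega>)"
    and "distributed M lborel Z
        (normal_density 0 (sqrt (integral {0..T} (\<lambda>u. (s * exp (lam * S u))\<^sup>2))))"
proof -
  let ?g = "\<lambda>u. s * exp (lam * S u)"
  \<comment> \<open>Taking \<open>lim\<close> for every path, with a fixed value where the sums
    diverge, makes \<open>Z\<close> a function of \<open>W\<close> alone. The expression
    \<open>exp (lam * S T) * c T \<omega> - c 0 \<omega>\<close> equals it only almost surely and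
    need not be measurable with respect to \<open>W\<close>.\<close>
  define Z where "Z \<omega> = lim (\<lambda>n. wiener_sum W ?g T n \<omega>)" for \<omega>
  have limc: "AE \<omega> in M. (\<lambda>n. wiener_sum W ?g T n \<omega>) \<longlonglongrightarrow> exp (lam * S T) * c T \<omega> - c 0 \<omega>"
    using c[unfolded solves_additive_noise_sde_def, THEN conjunct2]
  proof eventually_elim
    case (elim \<omega>)
    have ci: "set_integrable lebesgue {0..t} (\<lambda>u. - lam * K u * c u \<omega>)"
      and ceq: "c t \<omega> = c 0 \<omega> + (LINT u:{0..t}|lebesgue. - lam * K u * c u \<omega>) + s * (W t \<omega> - W 0 \<omega>)"
      if "t \<ge> 0" for t
      using elim that by blast+
    have neg: "(\<lambda>u. - lam * K u * c u \<omega>) = (\<lambda>u. - (lam * K u * c u \<omega>))" by auto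
    have ceq': "c t \<omega> = c 0 \<omega> - integral {0..t} (\<lambda>u. lam * K u * c u \<omega>) + s * (W t \<omega> - W 0 \<omega>)"
      if t: "t \<ge> 0" for t
    proof -
      have "(LINT u:{0..t}|lebesgue. - lam * K u * c u \<omega>) = - integral {0..t} (\<lambda>u. lam * K u * c u \<omega>)"
        unfolding set_lebesgue_integral_eq_integral(2)[OF ci[OF t]]
        unfolding neg by (rule Henstock_Kurzweil_Integration.integral_neg)
      with ceq[OF t] show ?thesis by linarith
    qed
    have "(\<lambda>n. \<Sum>i<Suc n. exp (lam * S (grid T n (Suc i))) *
            (s * (W (grid T n (Suc i)) \<omega> - W 0 \<omega>) - s * (W (grid T n i) \<omega> - W 0 \<omega>)))
        \<longlonglongrightarrow> exp (lam * S T) * c T \<omega> - c 0 \<omega>"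
    proof (rule integrating_factor_sums[where k = "\<lambda>u. lam * K u" and x = "\<lambda>t. c t \<omega>"
          and L = "\<lambda>u. lam * S u" and b = "\<lambda>t. s * (W t \<omega> - W 0 \<omega>)", OF T])
      show "(\<lambda>u. lam * K u) integrable_on {0..T}"
        using locally_integrable_halfline_integral(1)[OF K_int, of T] T by (intro integrable_on_mult_right) auto
      show "0 \<le> lam * K u" if "u \<in> {0..T}" for u
        using K_nonneg[of u] lam that by auto
      show "continuous_on {0..T} (\<lambda>t. c t \<omega>)"
        by (rule continuous_on_subset[OF conjunct1[OF elim]]) auto
      show "(\<lambda>u. lam * K u * c u \<omega>) integrable_on {0..T}"
        using set_lebesgue_integral_eq_integral(1)[OF ci[of T]] T
        unfolding neg integrable_neg_iff by simp
      show "c t \<omega> = c 0 \<omega> - integral {0..t} (\<lambda>u. lam * K u * c u \<omega>) + s * (W t \<omega> - W 0 \<omega>)"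
        if "t \<in> {0..T}" for t
        using that by (intro ceq') simp
      show "lam * S t = integral {0..t} (\<lambda>u. lam * K u)" if "t \<in> {0..T}" for t
        using S_eq[of t] locally_integrable_halfline_integral(2)[OF K_int, of t] that by simp
    qed
    \<comment> \<open>The starting value \<open>W 0\<close> cancels in the increments of
      \<open>s * (W t \<omega> - W 0 \<omega>)\<close>, which leaves the summands of
      \<open>wiener_sum\<close>.\<close>
    then show ?case
      unfolding wiener_sum_def by (simp only: right_diff_distrib[symmetric] mult.assoc[symmetric]
          mult.commute[of s] diff_diff_eq2 diff_add_cancel) (simp add: algebra_simps)
  qed
  then have lim: "AE \<omega> in M. (\<lambda>n. wiener_sum W ?g T n \<omega>) \<longlonglongrightarrow> Z \<omega>"
    unfolding Z_def convergent_LIMSEQ_iff[symmetric] by eventually_elim (rule convergentI)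
  have "AE \<omega> in M. c T \<omega> = exp (- lam * S T) * (c 0 \<omega> + Z \<omega>)"
    using limc
  proof eventually_elim
    case (elim \<omega>)
    then have "Z \<omega> = exp (lam * S T) * c T \<omega> - c 0 \<omega>"
      unfolding Z_def by (rule limI)
    then show ?case by (simp add: exp_minus)
  qed
  moreover have "Z \<in> borel_measurable
      (vimage_algebra (space M) (\<lambda>\<omega>. \<lambda>t\<in>{0..}. W t \<omega>) (Pi\<^sub>M {0..} (\<lambda>_. borel)))"
    unfolding Z_def
    by (intro borel_measurable_lim_metric wiener_sum_measurable process_measurable_vimage_algebra T) simp
  moreover have "distributed M lborel Z (normal_density 0 (sqrt (integral {0..T} (\<lambda>u. (?g u)\<^sup>2))))"
  proof (rule wiener_sum_limit_normal[OF W T _ _ _ lim])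
    show "continuous_on {0..T} ?g"
      using T by (intro continuous_intros continuous_on_indefinite_LINT[OF K_int S_eq]) auto
    show "random_variable borel Z"
      unfolding Z_def using W
      by (intro borel_measurable_lim_metric wiener_sum_measurable T)
        (simp add: standard_brownian_motion_def)
  qed (use s in simp)
  ultimately show ?thesis using that by blast
qed

theorem proposition2:
  fixes M :: "'a measure"
    and n :: nat and A :: "real mat"
    and K S m v :: "real \<Rightarrow> real"
    and lam D :: real
    and W c :: "real \<Rightarrow> 'a \<Rightarrow> real"
  assumes "prob_space M"
    and "weighted_adjacency n A" and "weighted_connected n A"
    and "eigenvalue (graph_laplacian n A) lam" and "lam > 0"
    and "\<And>t. t \<ge> 0 \<Longrightarrow> K t \<ge> 0" and "locally_integrable_halfline K"
    and "\<And>t. t \<ge> 0 \<Longrightarrow> S t = (LINT u:{0..t}|lebesgue. K u)"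
    and "D > 0"
    and "prob_space.standard_brownian_motion M W"
    and "prob_space.solves_additive_noise_sde M (\<lambda>t x. - lam * K t * x) (sqrt (2 * D)) W c"
    and "integrable M (\<lambda>\<omega>. (c 0 \<omega>)\<^sup>2)"
    and "prob_space.indep_of_process M (c 0) W"
    and "\<And>t. t \<ge> 0 \<Longrightarrow> m t = prob_space.expectation M (c t)"
    and "\<And>t. t \<ge> 0 \<Longrightarrow> v t = prob_space.variance M (c t)"
  shows "\<forall>t\<ge>0. integrable M (\<lambda>\<omega>. (c t \<omega>)\<^sup>2) \<and>
           m t = m 0 * exp (- lam * S t) \<and>
           v t = v 0 * exp (- 2 * lam * S t)
                 + 2 * D * (LINT u:{0..t}|lebesgue. exp (- 2 * lam * (S t - S u)))"
proof (intro allI impI)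
  interpret prob_space M by fact
  note K = \<open>\<And>t. t \<ge> 0 \<Longrightarrow> K t \<ge> 0\<close> \<open>locally_integrable_halfline K\<close>
    \<open>\<And>t. t \<ge> 0 \<Longrightarrow> S t = (LINT u:{0..t}|lebesgue. K u)\<close>
  note m = \<open>\<And>t. t \<ge> 0 \<Longrightarrow> m t = expectation (c t)\<close>
  note v = \<open>\<And>t. t \<ge> 0 \<Longrightarrow> v t = variance (c t)\<close>
  fix t :: real assume t0: "t \<ge> 0"
  have Sc: "continuous_on {0..t} S" by (rule continuous_on_indefinite_LINT[OF K(2,3) t0])
  have LINT: "(LINT u:{0..t}|lebesgue. exp (- 2 * lam * (S t - S u)))
      = integral {0..t} (\<lambda>u. exp (- 2 * lam * (S t - S u)))"
    by (intro set_lebesgue_integral_eq_integral(2) absolutely_integrable_continuous_real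
        continuous_intros Sc)
  show "integrable M (\<lambda>\<omega>. (c t \<omega>)\<^sup>2) \<and> m t = m 0 * exp (- lam * S t) \<and>
      v t = v 0 * exp (- 2 * lam * S t)
        + 2 * D * (LINT u:{0..t}|lebesgue. exp (- 2 * lam * (S t - S u)))"
  \<comment> \<open>At time 0 the Gaussian part would have variance 0 and hence no density. This
    case is settled directly, since integrals over \<open>{0..0}\<close> vanish.\<close>
  proof (cases "t = 0")
    case True
    then show ?thesis
      using K(3)[of 0] locally_integrable_halfline_integral(2)[OF K(2), of 0] assms(12) LINT by simp
  next
    case False
    with t0 have T: "t > 0" by simp
    have s: "sqrt (2 * D) > 0" using \<open>D > 0\<close> by simp
    obtain Z where Zm: "Z \<in> borel_measurable
        (vimage_algebra (space M) (\<lambda>\<omega>. \<lambda>t\<in>{0..}. W t \<omega>) (Pi\<^sub>M {0..} (\<lambda>_. borel)))"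
      and Zc: "AE \<omega> in M. c t \<omega> = exp (- lam * S t) * (c 0 \<omega> + Z \<omega>)"
      and Zd: "distributed M lborel Z
        (normal_density 0 (sqrt (integral {0..t} (\<lambda>u. (sqrt (2 * D) * exp (lam * S u))\<^sup>2))))"
      by (rule linear_sde_solution[OF K less_imp_le[OF \<open>lam > 0\<close>] s T assms(10,11)]) blast
    have cm: "random_variable borel (c r)" if "r \<ge> 0" for r
      using assms(11) that unfolding solves_additive_noise_sde_def by blast
    have ind: "indep_var borel (c 0) borel Z"
      by (rule indep_of_process_imp_indep_var[OF assms(13) cm Zm]) simp
    let ?I = "integral {0..t} (\<lambda>u. exp (2 * lam * S u))"
    have sq: "(sqrt (2 * D) * exp (lam * S u))\<^sup>2 = 2 * D * exp (2 * lam * S u)" for u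
      using \<open>D > 0\<close> by (simp add: power_mult_distrib exp_double[symmetric] mult.assoc)
    have cont: "continuous_on {0..t} (\<lambda>u. exp (2 * lam * S u))" by (intro continuous_intros Sc)
    \<comment> \<open>A nonnegative continuous function with integral 0 on a nondegenerate interval
      vanishes there, which the exponential does not.\<close>
    have "?I \<noteq> 0" using integral_eq_0_iff[OF cont T] T by force
    moreover have "?I \<ge> 0" by (intro integral_nonneg integrable_continuous_real cont) auto
    ultimately have I: "?I > 0" by simp
    then have \<sigma>: "sqrt (2 * D * ?I) > 0" using \<open>D > 0\<close> by simp
    have Zd': "distributed M lborel Z (normal_density 0 (sqrt (2 * D * ?I)))"
      using Zd unfolding sq by simp
    note moments = moments_add_indep_normal[OF cm[OF order_refl] assms(12) \<sigma> Zd' ind cm[OF t0] Zc]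
    \<comment> \<open>The integral in the claim is \<open>?I\<close> scaled by
      \<open>exp (- 2 * lam * S t)\<close>, the square of the factor in front of
      \<open>c 0 \<omega> + Z \<omega>\<close>.\<close>
    have "integral {0..t} (\<lambda>u. exp (- 2 * lam * (S t - S u)))
        = integral {0..t} (\<lambda>u. exp (- 2 * lam * S t) * exp (2 * lam * S u))"
      by (simp add: exp_add[symmetric] algebra_simps)
    then have J: "integral {0..t} (\<lambda>u. exp (- 2 * lam * (S t - S u))) = exp (- 2 * lam * S t) * ?I"
      by simp
    have "(exp (- lam * S t))\<^sup>2 = exp (- 2 * lam * S t)"
      by (simp add: exp_double[symmetric] mult.assoc)
    then have "v t = exp (- 2 * lam * S t) * (v 0 + 2 * D * ?I)"
      using moments(3) v[OF t0] v[of 0] I \<open>D > 0\<close> by simp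
    then have "v t = v 0 * exp (- 2 * lam * S t)
        + 2 * D * (LINT u:{0..t}|lebesgue. exp (- 2 * lam * (S t - S u)))"
      unfolding LINT J by (simp only: distrib_left ac_simps)
    then show ?thesis
      using moments(1,2) m[OF t0] m[of 0] by (simp add: mult.commute)
  qed
qed

end
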